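(* Let $M\ge2$ and let $\vec p=(p_1,\dots,p_M)$ be pairwise coprime integers $p_j\ge2$. Let $D=2^{-(M-1)}\prod_{j=1}^M(p_j-1)$, let $\gamma(\vec p)$ be the number of $M$-tuples $\vec\ell$, among the $D$ inequivalent ones (i.e. counted modulo $\vec\ell\sim\sigma_i\sigma_j(\vec\ell)$), with $C_{\vec p}(\vec\ell)\ne0$, and let $L(\vec p)$ be the number of integral lattice points $\vec\ell\in\mathbb Z_{>0}^M$ with $$0<\sum_{j=1}^M\frac{\ell_j}{p_j}<1 .$$ Then $$D-\gamma(\vec p)\ \ge\ L(\vec p).$$
   Context: $P=\prod_{j=1}^Mp_j$. For an $M$-tuple $\vec\ell=(\ell_1,\dots,\ell_M)$ of integers with $1\le\ell_j\le p_j-1$, $\chi_{2P}^{\vec\ell}:\mathbb Z\to\mathbb Z$ has period $2P$, with $\chi_{2P}^{\vec\ell}(n)=-\prod_j\varepsilon_j$ if $n\equiv P\left(1+\sum_{j}\varepsilon_j\ell_j/p_j\right)\bmod 2P$ for some $\varepsilon_j\in\{\pm1\}$, and $0$ otherwise. Define $$C_{\vec p}(\vec\ell)=\sum_{n=1}^{2P}\chi_{2P}^{\vec\ell}(n)\,B_{M-2}\!\left(\frac{n}{2P}\right),$$ where $B_k(x)$ is the $k$-th Bernoulli polynomial, $\frac{te^{xt}}{e^t-1}=\sum_kB_k(x)\frac{t^k}{k!}$. $\sigma_j(\vec\ell)$ denotes $\vec\ell$ with $\ell_j$ replaced by $p_j-\ell_j$. One has $\chi_{2P}^{\sigma_i\sigma_j(\vec\ell)}=\chi_{2P}^{\vec\ell}$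 and hence $C_{\vec p}(\sigma_i\sigma_j(\vec\ell))=C_{\vec p}(\vec\ell)$ for all $i,j$; there are exactly $D$ equivalence classes of $M$-tuples modulo $\vec\ell\sim\sigma_i\sigma_j(\vec\ell)$. *)

theory Defs
  imports "HOL-Analysis.Analysis" "HOL-Number_Theory.Cong"
begin

text \<open>
  Tuples $(p_1,\dots,p_M)$ are functions on indices of which only the values on $\{1..M\}$ matter;
  where tuples are counted, they are taken from an extensional function space.
\<close>

definition bernoulli_poly :: "nat \<Rightarrow> real \<Rightarrow> real" where
  "bernoulli_poly k x = fact k * fps_nth (fps_X * fps_exp x / (fps_exp 1 - 1)) k"

text \<open>Division of formal power series cancels the common factor $t$, so this is the usual
  generating function.\<close>

lemma bernoulli_poly_gen_fun:
  "Abs_fps (\<lambda>k. bernoulli_poly k x / fact k) * (fps_exp 1 - 1) = fps_X * fps_exp x"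
proof -
  let ?E = "fps_exp 1 - 1 :: real fps"
  have nth1: "fps_nth ?E 1 = 1" by simp
  hence nz: "?E \<noteq> 0" by (metis fps_zero_nth zero_neq_one)
  have "subdegree ?E = 1" by (rule subdegreeI) (use nth1 in auto)
  moreover have "1 \<le> subdegree (fps_X * fps_exp x :: real fps)" by simp
  ultimately have "?E dvd fps_X * fps_exp x" using nz by (simp add: fps_dvd_iff)
  hence "fps_X * fps_exp x / ?E * ?E = fps_X * fps_exp x" by simp
  moreover have "Abs_fps (\<lambda>k. bernoulli_poly k x / fact k) = fps_X * fps_exp x / ?E"
    by (rule fps_ext) (simp add: bernoulli_poly_def)
  ultimately show ?thesis by simp
qed

definition bigP :: "nat \<Rightarrow> (nat \<Rightarrow> int) \<Rightarrow> int" where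
  "bigP M p = (\<Prod>j=1..M. p j)"

definition sign_tuples :: "nat \<Rightarrow> (nat \<Rightarrow> int) set" where
  "sign_tuples M = ({1..M} \<rightarrow>\<^sub>E {-1, 1})"

text \<open>The integer $P(1 + \sum_j \varepsilon_j \ell_j / p_j)$; each division is exact.\<close>

definition residue_pt :: "nat \<Rightarrow> (nat \<Rightarrow> int) \<Rightarrow> (nat \<Rightarrow> int) \<Rightarrow> (nat \<Rightarrow> int) \<Rightarrow> int" where
  "residue_pt M p l e = bigP M p + (\<Sum>j=1..M. e j * l j * (bigP M p div p j))"

lemma residue_pt_eq:
  assumes "\<forall>j\<in>{1..M}. p j \<noteq> 0"
  shows "real_of_int (residue_pt M p l e) =
           of_int (bigP M p) * (1 + (\<Sum>j=1..M. of_int (e j) * of_int (l j) / of_int (p j)))"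
proof -
  have "real_of_int (bigP M p div p j) = of_int (bigP M p) / of_int (p j)" if "j \<in> {1..M}" for j
    unfolding bigP_def by (intro real_of_int_div dvd_prodI that) simp
  thus ?thesis
    unfolding residue_pt_def
    by (simp add: distrib_left sum_distrib_left mult_ac)
qed

text \<open>The sign tuple representing a residue is unique by \<open>residue_pt_unique\<close> below, so that
  the description operator picks the only candidate.\<close>

definition chi :: "nat \<Rightarrow> (nat \<Rightarrow> int) \<Rightarrow> (nat \<Rightarrow> int) \<Rightarrow> int \<Rightarrow> int" where
  "chi M p l n =
     (if \<exists>e\<in>sign_tuples M. [n = residue_pt M p l e] (mod (2 * bigP M p))
      then - (\<Prod>j=1..M. (THE e. e \<in> sign_tuples M \<and>
                              [n = residue_pt M p l e] (mod (2 * bigP M p))) j)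
      else 0)"

definition C :: "nat \<Rightarrow> (nat \<Rightarrow> int) \<Rightarrow> (nat \<Rightarrow> int) \<Rightarrow> real" where
  "C M p l = (\<Sum>n=1..2 * bigP M p.
                of_int (chi M p l n) * bernoulli_poly (M - 2) (of_int n / of_int (2 * bigP M p)))"

definition ell_tuples :: "nat \<Rightarrow> (nat \<Rightarrow> int) \<Rightarrow> (nat \<Rightarrow> int) set" where
  "ell_tuples M p = (\<Pi>\<^sub>E j\<in>{1..M}. {1..p j - 1})"

definition sigma :: "(nat \<Rightarrow> int) \<Rightarrow> nat \<Rightarrow> (nat \<Rightarrow> int) \<Rightarrow> (nat \<Rightarrow> int)" where
  "sigma p j l = l(j := p j - l j)"

text \<open>The equivalence relation on the tuples generated by $\ell \sim \sigma_i\sigma_j(\ell)$.\<close>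

definition ell_step :: "nat \<Rightarrow> (nat \<Rightarrow> int) \<Rightarrow> (nat \<Rightarrow> int) rel" where
  "ell_step M p = {(l, sigma p i (sigma p j l)) | l i j.
                     l \<in> ell_tuples M p \<and> i \<in> {1..M} \<and> j \<in> {1..M}}"

definition ell_equiv :: "nat \<Rightarrow> (nat \<Rightarrow> int) \<Rightarrow> (nat \<Rightarrow> int) rel" where
  "ell_equiv M p = (ell_step M p \<union> (ell_step M p)\<inverse>)\<^sup>* \<inter> ell_tuples M p \<times> ell_tuples M p"

lemma equiv_ell_equiv: "equiv (ell_tuples M p) (ell_equiv M p)"
proof (rule equivI)
  have "sym (ell_step M p \<union> (ell_step M p)\<inverse>)" by (auto simp: sym_def)
  thus "sym (ell_equiv M p)"
    unfolding ell_equiv_def by (intro sym_Int sym_rtrancl) (auto simp: sym_def)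
  show "trans (ell_equiv M p)"
    unfolding ell_equiv_def by (intro trans_Int trans_rtrancl) (auto simp: trans_def)
qed (auto simp: ell_equiv_def refl_on_def)

definition D :: "nat \<Rightarrow> (nat \<Rightarrow> int) \<Rightarrow> real" where
  "D M p = (\<Prod>j=1..M. of_int (p j) - 1) / 2 ^ (M - 1)"

text \<open>\<^const>\<open>C\<close> is constant on classes (for pairwise coprime \<open>p j\<close>), so it does not matter
  which representative is used.\<close>

definition gamma :: "nat \<Rightarrow> (nat \<Rightarrow> int) \<Rightarrow> nat" where
  "gamma M p = card {c \<in> ell_tuples M p // ell_equiv M p. \<exists>l\<in>c. C M p l \<noteq> 0}"

definition L :: "nat \<Rightarrow> (nat \<Rightarrow> int) \<Rightarrow> nat" where
  "L M p = card {l \<in> {1..M} \<rightarrow>\<^sub>E {0<..}.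
                   0 < (\<Sum>j=1..M. real_of_int (l j) / of_int (p j)) \<and>
                   (\<Sum>j=1..M. real_of_int (l j) / of_int (p j)) < 1}"

lemma residue_pt_unique:
  assumes p: "\<forall>j\<in>{1..M}. 2 \<le> p j"
    and cop: "\<forall>i\<in>{1..M}. \<forall>j\<in>{1..M}. i \<noteq> j \<longrightarrow> coprime (p i) (p j)"
    and l: "l \<in> ell_tuples M p"
    and e: "e \<in> sign_tuples M" and e': "e' \<in> sign_tuples M"
    and cong: "[residue_pt M p l e = residue_pt M p l e'] (mod (2 * bigP M p))"
  shows "e = e'"
proof -
  have "e k = e' k" if k: "k \<in> {1..M}" for k
  proof (rule ccontr)
    assume ne: "e k \<noteq> e' k"
    define Q where "Q = (\<Prod>j\<in>{1..M} - {k}. p j)"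
    have sgn: "e j = -1 \<or> e j = 1" "e' j = -1 \<or> e' j = 1" if "j \<in> {1..M}" for j
      using e e' that unfolding sign_tuples_def by (force dest: PiE_mem)+
    have PQ: "bigP M p = p k * Q"
      unfolding bigP_def Q_def using k by (simp add: prod.remove)
    have div_k: "bigP M p div p k = Q" using PQ p k by force
    define d where "d j = (e j - e' j) div 2" for j
    have d: "e j - e' j = 2 * d j" if "j \<in> {1..M}" for j
      using sgn[OF that] by (auto simp: d_def)
    have "residue_pt M p l e - residue_pt M p l e' =
            (\<Sum>j=1..M. (e j - e' j) * l j * (bigP M p div p j))"
      by (simp add: residue_pt_def sum_subtractf algebra_simps)
    also have "\<dots> = 2 * (\<Sum>j=1..M. d j * l j * (bigP M p div p j))"
      by (simp add: d sum_distrib_left mult_ac)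
    finally have "bigP M p dvd (\<Sum>j=1..M. d j * l j * (bigP M p div p j))"
      using cong by (simp add: cong_iff_dvd_diff)
    hence "p k dvd (\<Sum>j=1..M. d j * l j * (bigP M p div p j))"
      using PQ by (metis dvd_mult_left)
    moreover have "p k dvd (\<Sum>j\<in>{1..M} - {k}. d j * l j * (bigP M p div p j))"
    proof (rule dvd_sum)
      fix j assume j: "j \<in> {1..M} - {k}"
      have "bigP M p = p j * (\<Prod>i\<in>{1..M} - {j}. p i)"
        unfolding bigP_def using j by (simp add: prod.remove)
      hence "bigP M p div p j = (\<Prod>i\<in>{1..M} - {j}. p i)" using p j by force
      moreover have "p k dvd (\<Prod>i\<in>{1..M} - {j}. p i)"
        using j k by (intro dvd_prodI) auto
      ultimately show "p k dvd d j * l j * (bigP M p div p j)" by simp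
    qed
    ultimately have "p k dvd d k * l k * Q"
      using k by (simp add: sum.remove div_k dvd_add_left_iff)
    moreover have "coprime (p k) Q"
      unfolding Q_def using cop k by (intro prod_coprime_right) auto
    ultimately have "p k dvd d k * l k" by (simp add: coprime_dvd_mult_left_iff)
    moreover have "d k = 1 \<or> d k = -1" using sgn[OF k] ne by (auto simp: d_def)
    ultimately have "p k dvd l k" by auto
    moreover have "1 \<le> l k" "l k \<le> p k - 1"
      using l k unfolding ell_tuples_def by (auto dest: PiE_mem)
    ultimately show False using zdvd_imp_le by fastforce
  qed
  thus ?thesis using e e' unfolding sign_tuples_def by (auto intro: PiE_ext)
qed

end

theory Submission
  imports Defs
begin

text \<open>
  Call a tuple with \<open>\<Sum>j. l j / p j < 1\<close> small.  The theorem holds because small tuples lie in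
  pairwise different classes and \<^const>\<open>C\<close> vanishes on each of these classes, while there are at
  most \<^term>\<open>D M p\<close> classes altogether.

  The vanishing is a finite-difference phenomenon.  For a small tuple all the points
  \<open>P * (1 + (\<Sum>j. e j * l j / p j))\<close> lie strictly between \<open>0\<close> and \<open>2 * P\<close>, so no reduction modulo
  \<open>2 * P\<close> takes place and \<^const>\<open>C\<close> is, up to sign, the sum over all sign tuples \<open>e\<close> of
  \<open>(\<Prod>j. e j) * B (1/2 + (\<Sum>j. e j * h j))\<close> with \<open>h j = l j / (2 * p j)\<close> and \<open>B\<close> the Bernoulli
  polynomial of degree \<open>M - 2\<close>.  This is an \<open>M\<close>-fold central difference of a polynomial of degree
  less than \<open>M\<close> (\<open>alternating_bernoulli_sum_eq_0\<close>, \<open>C_eq_0_if_small\<close>).  Invariance of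
  \<^const>\<open>C\<close> under \<open>\<sigma>\<^sub>i\<sigma>\<^sub>j\<close> (\<open>C_sigma_sigma\<close>) spreads the vanishing over the class.

  Equivalent tuples differ by reflecting \<open>l j\<close> to \<open>p j - l j\<close> at an even number of places.  If two
  equivalent small tuples were different, at least two places would be reflected, and each of these
  contributes \<open>1\<close> to the total of the two sums \<open>\<Sum>j. l j / p j\<close>, which is less than \<open>2\<close>
  (\<open>small_equiv_imp_eq\<close>).

  At most one \<open>p j\<close> is even, so one can choose a pivot coordinate such that no reflection in
  another coordinate has a fixed point.  Reflecting the other coordinates freely, and using the
  pivot to correct the parity, gives
  \<open>2 ^ (M - 1)\<close> different tuples in each class (\<open>class_card_ge\<close>), which bounds the number of
  classes by \<^term>\<open>D M p\<close>.
\<close>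

section \<open>Alternating sums of Bernoulli polynomials\<close>

lemma bernoulli_gen_fun_factor:
  "Abs_fps (\<lambda>k. bernoulli_poly k x / fact k) =
     Abs_fps (\<lambda>k. bernoulli_poly k 0 / fact k) * fps_exp x"
proof -
  have "fps_nth (fps_exp 1 - 1 :: real fps) 1 = 1" by simp
  hence nz: "fps_exp 1 - 1 \<noteq> (0 :: real fps)" by (metis fps_zero_nth zero_neq_one)
  have "Abs_fps (\<lambda>k. bernoulli_poly k x / fact k) * (fps_exp 1 - 1) =
        (Abs_fps (\<lambda>k. bernoulli_poly k 0 / fact k) * (fps_exp 1 - 1)) * fps_exp x"
    unfolding bernoulli_poly_gen_fun by simp
  thus ?thesis using nz by (simp add: mult_ac)
qed

lemma fps_exp_sum:
  fixes h :: "'a \<Rightarrow> real"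
  assumes "finite A"
  shows "fps_exp (\<Sum>j\<in>A. h j) = (\<Prod>j\<in>A. fps_exp (h j))"
  using assms by (induction A rule: finite_induct) (auto simp: fps_exp_add_mult)

lemma fps_nth_prod_eq_0:
  fixes f :: "'a \<Rightarrow> real fps"
  assumes "finite A" and "\<And>j. j \<in> A \<Longrightarrow> fps_nth (f j) 0 = 0" and "k < card A"
  shows "fps_nth (g * (\<Prod>j\<in>A. f j)) k = 0"
proof -
  have "fps_X dvd f j" if "j \<in> A" for j
  proof -
    have "f j = fps_X * fps_shift 1 (f j)"
      by (rule fps_ext) (use assms(2)[OF that] in auto)
    thus ?thesis by (rule dvdI)
  qed
  hence "(\<Prod>j\<in>A. fps_X) dvd (\<Prod>j\<in>A. f j)" by (rule prod_dvd_prod)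
  then obtain q where "(\<Prod>j\<in>A. f j) = fps_X ^ card A * q" by (auto elim: dvdE)
  hence eq: "g * (\<Prod>j\<in>A. f j) = fps_X ^ card A * (g * q)" by (simp only: mult.left_commute)
  show ?thesis unfolding eq fps_X_power_mult_nth using assms(3) by simp
qed

text \<open>The vanishing of an \<open>M\<close>-fold central difference of a polynomial of degree \<open>k < M\<close>.  In terms
  of generating functions, the Bernoulli series at \<open>x\<close> is the one at \<open>0\<close> times \<open>exp (x * t)\<close>, and
  the alternating sum of the series \<open>exp ((\<Sum>j. e j * h j) * t)\<close> over all \<open>e\<close> factors into \<open>M\<close> series \<open>exp (h j * t) - exp (- h j * t)\<close>, each divisible by \<open>t\<close>.\<close>

lemma alternating_bernoulli_sum_eq_0:
  fixes h :: "nat \<Rightarrow> real"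
  assumes "k < M"
  shows "(\<Sum>e\<in>sign_tuples M. of_int (\<Prod>j=1..M. e j) *
            bernoulli_poly k (a + (\<Sum>j=1..M. of_int (e j) * h j))) = 0"
proof -
  define F where "F x = Abs_fps (\<lambda>k. bernoulli_poly k x / fact k)" for x
  let ?x = "\<lambda>e :: nat \<Rightarrow> int. a + (\<Sum>j=1..M. of_int (e j) * h j)"
  have "(\<Sum>e\<in>sign_tuples M. of_int (\<Prod>j=1..M. e j) * F (?x e)) =
        (\<Sum>e\<in>sign_tuples M. F 0 * fps_exp a *
            (\<Prod>j=1..M. of_int (e j) * fps_exp (of_int (e j) * h j)))"
  proof (rule sum.cong)
    fix e
    have "F (?x e) = F 0 * fps_exp (?x e)"
      unfolding F_def by (rule bernoulli_gen_fun_factor)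
    also have "\<dots> = F 0 * fps_exp a * (\<Prod>j=1..M. fps_exp (of_int (e j) * h j))"
      by (simp add: fps_exp_add_mult fps_exp_sum mult_ac)
    finally show "of_int (\<Prod>j=1..M. e j) * F (?x e) = F 0 * fps_exp a *
            (\<Prod>j=1..M. of_int (e j) * fps_exp (of_int (e j) * h j))"
      by (simp add: prod.distrib mult_ac)
  qed simp
  also have "\<dots> = F 0 * fps_exp a *
      (\<Prod>j=1..M. \<Sum>s\<in>{-1, 1::int}. of_int s * fps_exp (of_int s * h j))"
    unfolding sign_tuples_def
    by (subst prod_sum_PiE) (simp_all add: sum_distrib_left)
  finally have eq: "(\<Sum>e\<in>sign_tuples M. of_int (\<Prod>j=1..M. e j) * F (?x e)) = \<dots>" .
  have "fps_nth (\<Sum>e\<in>sign_tuples M. of_int (\<Prod>j=1..M. e j) * F (?x e)) k = 0"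
    unfolding eq by (rule fps_nth_prod_eq_0) (use assms in auto)
  moreover have "fps_nth (of_int c * F x) k = of_int c * bernoulli_poly k x / fact k" for c x
    by (simp add: F_def flip: fps_of_int)
  ultimately have "(\<Sum>e\<in>sign_tuples M. of_int (\<Prod>j=1..M. e j) *
            bernoulli_poly k (?x e)) / fact k = 0"
    by (simp only: fps_sum_nth sum_divide_distrib)
  thus ?thesis by simp
qed

section \<open>Reflections and the function \<open>\<chi>\<close>\<close>

lemma prod_negate_one:
  fixes s :: "'a \<Rightarrow> 'b::comm_ring_1"
  assumes "finite A" "i \<in> A"
  shows "(\<Prod>j\<in>A. (s(i := - s i)) j) = - (\<Prod>j\<in>A. s j)"
  using assms by (simp add: prod.remove[of A i])

lemma sign_tuples_flip:
  "e \<in> sign_tuples M \<Longrightarrow> i \<in> {1..M} \<Longrightarrow> e(i := - e i) \<in> sign_tuples M"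
  unfolding sign_tuples_def by (fastforce simp: PiE_iff extensional_def)

lemma sign_tuples_cases:
  "e \<in> sign_tuples M \<Longrightarrow> i \<in> {1..M} \<Longrightarrow> e i = -1 \<or> e i = 1"
  unfolding sign_tuples_def by (force dest: PiE_mem)

lemma sigma_sigma_involution: "sigma p i (sigma p j (sigma p i (sigma p j l))) = l"
  by (auto simp: sigma_def)

lemma sigma_ell_tuples:
  "l \<in> ell_tuples M p \<Longrightarrow> i \<in> {1..M} \<Longrightarrow> sigma p i l \<in> ell_tuples M p"
  unfolding ell_tuples_def sigma_def by (force simp: PiE_iff extensional_def)

text \<open>Flipping the sign at \<open>i\<close> compensates the reflection at \<open>i\<close> up to a shift by \<open>P\<close>, because
  \<open>- e i * (p i - l i) / p i = e i * l i / p i - e i\<close>.  A second such step restores the point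
  modulo \<open>2P\<close>, which is why the reflections have to come in pairs.\<close>

lemma residue_pt_sigma:
  assumes "i \<in> {1..M}" and "p i \<noteq> 0"
  shows "residue_pt M p (sigma p i l) (e(i := - e i)) = residue_pt M p l e - e i * bigP M p"
proof -
  have "p i dvd bigP M p"
    unfolding bigP_def using assms by (intro dvd_prodI) auto
  hence "bigP M p = p i * (bigP M p div p i)" by simp
  hence eP: "e i * bigP M p = e i * (p i * (bigP M p div p i))" by simp
  have split: "residue_pt M p l e = bigP M p + e i * l i * (bigP M p div p i) +
      (\<Sum>j\<in>{1..M} - {i}. e j * l j * (bigP M p div p j))" for l e
    unfolding residue_pt_def using assms(1) by (subst sum.remove[of _ i]) simp_all
  have "(\<Sum>j\<in>{1..M} - {i}. (e(i := - e i)) j * sigma p i l j * (bigP M p div p j)) =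
        (\<Sum>j\<in>{1..M} - {i}. e j * l j * (bigP M p div p j))"
    by (rule sum.cong) (auto simp: sigma_def)
  thus ?thesis
    unfolding split eP by (simp add: sigma_def algebra_simps)
qed

locale coprime_moduli =
  fixes M :: nat and p :: "nat \<Rightarrow> int"
  assumes p_ge_2: "\<And>j. j \<in> {1..M} \<Longrightarrow> 2 \<le> p j"
    and p_coprime: "\<And>i j. i \<in> {1..M} \<Longrightarrow> j \<in> {1..M} \<Longrightarrow> i \<noteq> j \<Longrightarrow> coprime (p i) (p j)"
begin

lemma bigP_pos: "0 < bigP M p"
  unfolding bigP_def by (rule prod_pos) (use p_ge_2 in force)

lemma chi_eq:
  assumes l: "l \<in> ell_tuples M p" and e: "e \<in> sign_tuples M"
    and n: "[n = residue_pt M p l e] (mod (2 * bigP M p))"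
  shows "chi M p l n = - (\<Prod>j=1..M. e j)"
proof -
  have "(THE e. e \<in> sign_tuples M \<and> [n = residue_pt M p l e] (mod (2 * bigP M p))) = e"
  proof (rule the_equality)
    fix e' assume "e' \<in> sign_tuples M \<and> [n = residue_pt M p l e'] (mod (2 * bigP M p))"
    with e n show "e' = e"
      by (intro residue_pt_unique[of M p l]) (use p_ge_2 p_coprime l in \<open>auto simp: cong_def\<close>)
  qed (use e n in auto)
  thus ?thesis unfolding chi_def using e n by auto
qed

lemma chi_sigma_sigma:
  assumes l: "l \<in> ell_tuples M p" and ij: "i \<in> {1..M}" "j \<in> {1..M}"
  shows "chi M p (sigma p i (sigma p j l)) n = chi M p l n"
proof (cases "i = j")
  case True
  thus ?thesis by (simp add: sigma_def)
next
  case False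
  let ?rep = "\<lambda>l e. e \<in> sign_tuples M \<and> [n = residue_pt M p l e] (mod (2 * bigP M p))"
  let ?ss = "\<lambda>l. sigma p i (sigma p j l)"
  let ?flip = "\<lambda>e :: nat \<Rightarrow> int. (e(j := - e j))(i := - (e(j := - e j)) i)"
  have transport: "?rep (?ss l) (?flip e)" if e: "?rep l e" for l e
  proof -
    have "p i \<noteq> 0" "p j \<noteq> 0" using p_ge_2 ij by force+
    hence "residue_pt M p (?ss l) (?flip e) =
          residue_pt M p l e - e j * bigP M p - (e(j := - e j)) i * bigP M p"
      by (metis residue_pt_sigma ij)
    hence eq: "residue_pt M p (?ss l) (?flip e) = residue_pt M p l e - (e i + e j) * bigP M p"
      using False by (simp add: algebra_simps)
    \<comment> \<open>Two signs have an even sum, so the two shifts by \<open>\<plusminus>P\<close> together vanish modulo \<open>2P\<close>.\<close>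
    have "even (e i + e j)"
      using sign_tuples_cases[of e M i] sign_tuples_cases[of e M j] e ij by auto
    hence "2 * bigP M p dvd (e i + e j) * bigP M p" by (intro mult_dvd_mono) auto
    hence "[residue_pt M p l e = residue_pt M p (?ss l) (?flip e)] (mod (2 * bigP M p))"
      unfolding eq by (simp add: cong_iff_dvd_diff)
    thus ?thesis using e ij by (metis sign_tuples_flip cong_trans)
  qed
  show ?thesis
  proof (cases "\<exists>e. ?rep l e")
    case True
    then obtain e where e: "?rep l e" by blast
    have "(\<Prod>k=1..M. ?flip e k) = (\<Prod>k=1..M. e k)"
      using ij by (subst prod_negate_one, simp, simp, subst prod_negate_one) auto
    moreover have "chi M p (?ss l) n = - (\<Prod>k=1..M. ?flip e k)"
      using transport[OF e] sigma_ell_tuples[OF sigma_ell_tuples[OF l ij(2)] ij(1)]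
      by (elim conjE) (rule chi_eq)
    moreover have "chi M p l n = - (\<Prod>k=1..M. e k)" using e l by (intro chi_eq) auto
    ultimately show ?thesis by simp
  next
    case no_rep: False
    hence "\<nexists>e. ?rep (?ss l) e"
      using transport[where l = "?ss l"] unfolding sigma_sigma_involution by blast
    with no_rep show ?thesis unfolding chi_def by auto
  qed
qed

lemma C_sigma_sigma:
  assumes "l \<in> ell_tuples M p" "i \<in> {1..M}" "j \<in> {1..M}"
  shows "C M p (sigma p i (sigma p j l)) = C M p l"
  unfolding C_def using chi_sigma_sigma[OF assms] by simp

text \<open>Smallness keeps every residue point inside \<open>{1..<2P}\<close>, so that the sum over \<open>n\<close> can be
  replaced by a sum over sign tuples evaluated at the unreduced points.\<close>

lemma C_eq_0_if_small:
  assumes M: "2 \<le> M" and l: "l \<in> ell_tuples M p"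
    and small: "(\<Sum>j=1..M. real_of_int (l j) / of_int (p j)) < 1"
  shows "C M p l = 0"
proof -
  let ?P = "bigP M p"
  let ?r = "residue_pt M p l"
  define y where "y e = (\<Sum>j=1..M. of_int (e j) * of_int (l j) / of_int (p j) :: real)"
    for e :: "nat \<Rightarrow> int"
  have r_eq: "real_of_int (?r e) = of_int ?P * (1 + y e)" for e
    unfolding y_def by (rule residue_pt_eq) (use p_ge_2 in force)
  have r_range: "0 < ?r e \<and> ?r e < 2 * ?P" if e: "e \<in> sign_tuples M" for e
  proof -
    have "\<bar>y e\<bar> \<le> (\<Sum>j=1..M. \<bar>of_int (e j) * of_int (l j) / of_int (p j)\<bar>)"
      unfolding y_def by (rule sum_abs)
    also have "\<dots> = (\<Sum>j=1..M. real_of_int (l j) / of_int (p j))"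
    proof (rule sum.cong)
      fix j assume j: "j \<in> {1..M}"
      have "0 \<le> l j" using l j unfolding ell_tuples_def by (force dest: PiE_mem)
      thus "\<bar>of_int (e j) * of_int (l j) / of_int (p j)\<bar> = real_of_int (l j) / of_int (p j)"
        using sign_tuples_cases[OF e j] p_ge_2[OF j] by auto
    qed simp
    finally have "\<bar>y e\<bar> < 1" using small by simp
    hence "0 < 1 + y e" "1 + y e < 2" by auto
    hence "0 < real_of_int (?r e)" "real_of_int (?r e) < of_int ?P * 2"
      unfolding r_eq using bigP_pos by (auto intro: mult_strict_left_mono)
    thus ?thesis by linarith
  qed
  have inj: "inj_on ?r (sign_tuples M)"
    by (rule inj_onI, rule residue_pt_unique[of M p l])
       (use p_ge_2 p_coprime l in auto)
  have chi_0: "chi M p l n = 0" if n: "n \<in> {1..2 * ?P} - ?r ` sign_tuples M" for n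
  proof -
    have "\<not> [n = ?r e] (mod (2 * ?P))" if e: "e \<in> sign_tuples M" for e
    proof
      assume "[n = ?r e] (mod (2 * ?P))"
      hence "2 * ?P dvd n - ?r e" by (simp add: cong_iff_dvd_diff)
      moreover have "\<bar>n - ?r e\<bar> < 2 * ?P" using r_range[OF e] n by auto
      ultimately have "n = ?r e" using dvd_imp_le_int[of "n - ?r e" "2 * ?P"] by force
      thus False using e n by auto
    qed
    thus ?thesis unfolding chi_def by auto
  qed
  have "C M p l = (\<Sum>n\<in>?r ` sign_tuples M.
          of_int (chi M p l n) * bernoulli_poly (M - 2) (of_int n / of_int (2 * ?P)))"
    unfolding C_def
    by (rule sum.mono_neutral_right) (use r_range chi_0 in \<open>force+\<close>)
  also have "\<dots> = (\<Sum>e\<in>sign_tuples M. of_int (chi M p l (?r e)) *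
                    bernoulli_poly (M - 2) (of_int (?r e) / of_int (2 * ?P)))"
    using inj by (simp add: sum.reindex)
  also have "\<dots> = - (\<Sum>e\<in>sign_tuples M. of_int (\<Prod>j=1..M. e j) *
      bernoulli_poly (M - 2) (1 / 2 + (\<Sum>j=1..M. of_int (e j) * (of_int (l j) / (2 * of_int (p j))))))"
    unfolding sum_negf[symmetric]
  proof (rule sum.cong)
    fix e assume e: "e \<in> sign_tuples M"
    have "of_int (?r e) / of_int (2 * ?P) = (1 + y e) / 2"
      unfolding r_eq using bigP_pos by simp
    also have "\<dots> = 1 / 2 + (\<Sum>j=1..M. of_int (e j) * (of_int (l j) / (2 * of_int (p j))))"
      unfolding y_def by (simp add: add_divide_distrib sum_divide_distrib mult_ac)
    finally show "of_int (chi M p l (?r e)) *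
        bernoulli_poly (M - 2) (of_int (?r e) / of_int (2 * ?P)) =
        - (of_int (\<Prod>j=1..M. e j) * bernoulli_poly (M - 2)
            (1 / 2 + (\<Sum>j=1..M. of_int (e j) * (of_int (l j) / (2 * of_int (p j))))))"
      using chi_eq[OF l e cong_refl] by simp
  qed simp
  also have "\<dots> = 0"
    by (subst alternating_bernoulli_sum_eq_0) (use M in auto)
  finally show ?thesis .
qed

section \<open>Equivalence classes of tuples\<close>

lemma ell_equiv_alt: "ell_equiv M p = (ell_step M p)\<^sup>* \<inter> ell_tuples M p \<times> ell_tuples M p"
proof -
  have "(ell_step M p)\<inverse> \<subseteq> ell_step M p"
  proof clarify
    fix a b assume "(b, a) \<in> ell_step M p"
    then obtain i j where ij: "i \<in> {1..M}" "j \<in> {1..M}" "b \<in> ell_tuples M p"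
      and a: "a = sigma p i (sigma p j b)"
      unfolding ell_step_def by auto
    have "b = sigma p i (sigma p j a)" unfolding a by (simp add: sigma_sigma_involution)
    moreover have "a \<in> ell_tuples M p" unfolding a using ij by (intro sigma_ell_tuples)
    ultimately show "(a, b) \<in> ell_step M p" unfolding ell_step_def using ij by blast
  qed
  thus ?thesis unfolding ell_equiv_def by (simp add: Un_absorb2)
qed

lemma C_ell_equiv:
  assumes "(l, l') \<in> ell_equiv M p"
  shows "C M p l' = C M p l"
proof -
  have "(l, l') \<in> (ell_step M p)\<^sup>*" using assms unfolding ell_equiv_alt by simp
  thus ?thesis
    by (induction rule: rtrancl_induct) (auto simp: ell_step_def C_sigma_sigma)
qed

text \<open>Centred at \<open>p j / 2\<close>, reflection is negation, so equivalence multiplies the centred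
  coordinates by signs.  Recording the signs, rather than the set of changed coordinates, keeps
  track of parity also when \<open>l j = p j / 2\<close> is fixed by its reflection.\<close>

lemma ell_equiv_signs:
  assumes "(l, l') \<in> ell_equiv M p"
  obtains s where "\<And>j. j \<in> {1..M} \<Longrightarrow> s j = -1 \<or> s j = 1"
    and "(\<Prod>j=1..M. s j) = 1"
    and "\<And>j. j \<in> {1..M} \<Longrightarrow> 2 * l' j - p j = s j * (2 * l j - p j)"
proof -
  define signed where "signed l' s \<longleftrightarrow> (\<forall>j\<in>{1..M}. s j = -1 \<or> s j = 1) \<and>
      (\<forall>j\<in>{1..M}. 2 * l' j - p j = s j * (2 * l j - p j))" for l' s
  have signed_sigma: "signed (sigma p i l') (s(i := - s i))" if "signed l' s" for i l' s
    using that unfolding signed_def by (auto simp: sigma_def algebra_simps)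
  have "(l, l') \<in> (ell_step M p)\<^sup>*" using assms unfolding ell_equiv_alt by simp
  hence "\<exists>s. signed l' s \<and> (\<Prod>j=1..M. s j) = 1"
  proof (induction rule: rtrancl_induct)
    case base
    have "signed l (\<lambda>_. 1)" by (simp add: signed_def)
    thus ?case by (intro exI[of _ "\<lambda>_. 1"]) simp
  next
    case (step a b)
    then obtain s i j where s: "signed a s" "(\<Prod>j=1..M. s j) = 1"
      and ij: "i \<in> {1..M}" "j \<in> {1..M}" and b: "b = sigma p i (sigma p j a)"
      unfolding ell_step_def by auto
    let ?t = "(s(j := - s j))(i := - (s(j := - s j)) i)"
    have "(\<Prod>k=1..M. ?t k) = (\<Prod>k=1..M. s k)"
      using ij by (subst prod_negate_one, simp, simp, subst prod_negate_one) auto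
    moreover have "signed b ?t" unfolding b by (intro signed_sigma s)
    ultimately show ?case using s(2) by metis
  qed
  thus thesis using that unfolding signed_def by blast
qed

lemma small_equiv_imp_eq:
  assumes eq: "(l, l') \<in> ell_equiv M p"
    and small: "(\<Sum>j=1..M. real_of_int (l j) / of_int (p j)) < 1"
    and small': "(\<Sum>j=1..M. real_of_int (l' j) / of_int (p j)) < 1"
  shows "l = l'"
proof -
  have l: "l \<in> ell_tuples M p" and l': "l' \<in> ell_tuples M p"
    using eq unfolding ell_equiv_def by auto
  obtain s where s: "\<And>j. j \<in> {1..M} \<Longrightarrow> s j = -1 \<or> s j = 1"
    and prod_s: "(\<Prod>j=1..M. s j) = 1"
    and ls: "\<And>j. j \<in> {1..M} \<Longrightarrow> 2 * l' j - p j = s j * (2 * l j - p j)"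
    using ell_equiv_signs[OF eq] by blast
  have s_1: "s i = 1" if i: "i \<in> {1..M}" for i
  proof (rule ccontr)
    assume "s i \<noteq> 1"
    hence si: "s i = -1" using s[OF i] by simp
    \<comment> \<open>The product of the signs is \<open>1\<close>, so a negative sign has a partner.\<close>
    obtain k where k: "k \<in> {1..M}" "k \<noteq> i" "s k = -1"
    proof (rule ccontr)
      assume "\<not> thesis"
      hence "(\<Prod>j\<in>{1..M} - {i}. s j) = 1" using s that by (intro prod.neutral) blast
      thus False using prod_s i si by (simp add: prod.remove[of _ i])
    qed
    let ?f = "\<lambda>j. real_of_int (l j) / of_int (p j) + of_int (l' j) / of_int (p j)"
    have one: "?f j = 1" if "j \<in> {1..M}" "s j = -1" for j
    proof -
      have "l j + l' j = p j" using ls[OF that(1)] that(2) by simp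
      hence "real_of_int (l j) + of_int (l' j) = of_int (p j)" by linarith
      thus ?thesis using p_ge_2[OF that(1)] by (simp flip: add_divide_distrib)
    qed
    have "2 = (\<Sum>j\<in>{i, k}. ?f j)" using one i k si by simp
    also have "\<dots> \<le> (\<Sum>j=1..M. ?f j)"
    proof (rule sum_mono2)
      fix j assume "j \<in> {1..M} - {i, k}"
      moreover from this have "0 \<le> l j" "0 \<le> l' j"
        using l l' unfolding ell_tuples_def by (force dest: PiE_mem)+
      ultimately show "0 \<le> ?f j" using p_ge_2[of j] by auto
    qed (use i k in auto)
    finally show False using small small' by (simp add: sum.distrib)
  qed
  have "l j = l' j" if "j \<in> {1..M}" for j
    using ls[OF that] s_1[OF that] by simp
  thus ?thesis using l l' unfolding ell_tuples_def by (auto intro: PiE_ext)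
qed

section \<open>Counting the classes\<close>

text \<open>A set \<open>T\<close> of coordinates other than the pivot \<open>k\<close> yields a class member by reflecting at
  each \<open>j \<in> T\<close> and once more at \<open>k\<close> for each such \<open>j\<close>.  With the only possible even \<open>p k\<close> at the
  pivot, \<open>l j \<noteq> p j - l j\<close> elsewhere, so \<open>T\<close> can be read off from the result.\<close>

lemma class_card_ge:
  assumes M: "1 \<le> M" and l: "l \<in> ell_tuples M p"
  shows "2 ^ (M - 1) \<le> card (ell_equiv M p `` {l})"
proof -
  obtain k where k: "k \<in> {1..M}" and odd: "\<And>j. j \<in> {1..M} - {k} \<Longrightarrow> odd (p j)"
  proof (cases "\<exists>k\<in>{1..M}. even (p k)")
    case True
    then obtain k where k: "k \<in> {1..M}" "even (p k)" by blast
    have "odd (p j)" if "j \<in> {1..M} - {k}" for j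
      using p_coprime[of k j] k that coprime_common_divisor[of "p k" "p j" 2] by auto
    with k(1) show ?thesis by (rule that)
  next
    case False
    thus ?thesis using M by (intro that[of 1]) auto
  qed
  let ?N = "{1..M} - {k}"
  define reflect where "reflect T =
    (\<lambda>j. if j \<in> T \<or> (j = k \<and> odd (card T)) then p j - l j else l j)" for T
  have mem: "(l, reflect T) \<in> ell_equiv M p" if "finite T" "T \<subseteq> ?N" for T
    using that
  proof (induction T rule: finite_induct)
    case empty
    show ?case using l by (simp add: reflect_def ell_equiv_def)
  next
    case (insert j T)
    have eq: "reflect (insert j T) = sigma p k (sigma p j (reflect T))"
      using insert by (auto simp: reflect_def sigma_def fun_eq_iff)
    have IH: "(l, reflect T) \<in> ell_equiv M p" using insert by auto
    hence T: "reflect T \<in> ell_tuples M p" by (auto simp: ell_equiv_def)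
    hence "(reflect T, reflect (insert j T)) \<in> ell_step M p"
      unfolding eq ell_step_def using k insert by auto
    moreover have "reflect (insert j T) \<in> ell_tuples M p"
      unfolding eq using T k insert by (intro sigma_ell_tuples) auto
    ultimately show ?case
      using IH unfolding ell_equiv_alt by (auto intro: rtrancl_into_rtrancl)
  qed
  have "inj_on reflect (Pow ?N)"
  proof (rule inj_onI)
    fix S T assume ST: "S \<in> Pow ?N" "T \<in> Pow ?N" and eq: "reflect S = reflect T"
    have "j \<in> S \<longleftrightarrow> j \<in> T" if j: "j \<in> ?N" for j
    proof -
      have "p j - l j \<noteq> l j"
      proof
        assume "p j - l j = l j"
        hence "p j = 2 * l j" by simp
        thus False using odd[OF j] by simp
      qed
      thus ?thesis using fun_cong[OF eq, of j] j by (auto simp: reflect_def split: if_splits)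
    qed
    thus "S = T" using ST by blast
  qed
  moreover have "reflect ` Pow ?N \<subseteq> ell_equiv M p `` {l}"
    using mem finite_subset[of _ ?N] by blast
  moreover have "finite (ell_equiv M p `` {l})"
    by (rule finite_subset[of _ "ell_tuples M p"])
       (auto simp: ell_equiv_def ell_tuples_def intro!: finite_PiE)
  ultimately have "card (Pow ?N) \<le> card (ell_equiv M p `` {l})"
    by (metis card_image card_mono)
  thus ?thesis using k by (simp add: card_Pow)
qed

lemma finite_ell_tuples: "finite (ell_tuples M p)"
  unfolding ell_tuples_def by (intro finite_PiE) auto

lemma finite_classes: "finite (ell_tuples M p // ell_equiv M p)"
  by (rule finite_quotient[OF finite_ell_tuples]) (auto simp: ell_equiv_def)

lemma card_classes_le_D:
  assumes M: "1 \<le> M"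
  shows "real (card (ell_tuples M p // ell_equiv M p)) \<le> D M p"
proof -
  let ?Q = "ell_tuples M p // ell_equiv M p"
  have class_finite: "finite c" if "c \<in> ?Q" for c
    using that Union_quotient[OF equiv_ell_equiv] finite_ell_tuples
    by (metis Union_upper finite_subset)
  have "card ?Q * 2 ^ (M - 1) = (\<Sum>c\<in>?Q. 2 ^ (M - 1))" by simp
  also have "\<dots> \<le> (\<Sum>c\<in>?Q. card c)"
    by (rule sum_mono) (auto elim!: quotientE simp del: One_nat_def intro: class_card_ge[OF M])
  also have "\<dots> = card (\<Union>?Q)"
  proof (rule card_Union_disjoint[symmetric])
    show "pairwise disjnt ?Q"
      unfolding pairwise_def disjnt_def using quotient_disj[OF equiv_ell_equiv] by blast
  qed (rule class_finite)
  also have "\<dots> = (\<Prod>j=1..M. nat (p j - 1))"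
    unfolding Union_quotient[OF equiv_ell_equiv]
    by (simp add: ell_tuples_def card_PiE)
  finally have "real (card ?Q * 2 ^ (M - 1)) \<le> real (\<Prod>j=1..M. nat (p j - 1))"
    by (simp only: of_nat_le_iff)
  also have "\<dots> = (\<Prod>j=1..M. of_int (p j) - 1)"
    unfolding of_nat_prod by (rule prod.cong) (use p_ge_2 in force)+
  finally show ?thesis unfolding D_def by (simp add: field_simps)
qed

lemma L_le_card_vanishing_classes:
  assumes M: "2 \<le> M"
  shows "L M p \<le> card {c \<in> ell_tuples M p // ell_equiv M p. \<forall>l\<in>c. C M p l = 0}"
proof -
  let ?small = "{l \<in> {1..M} \<rightarrow>\<^sub>E {0<..}.
      0 < (\<Sum>j=1..M. real_of_int (l j) / of_int (p j)) \<and>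
      (\<Sum>j=1..M. real_of_int (l j) / of_int (p j)) < 1}"
  let ?class = "\<lambda>l. ell_equiv M p `` {l}"
  have small_tuple: "l \<in> ell_tuples M p" if l: "l \<in> ?small" for l
  proof -
    have "l j \<in> {1..p j - 1}" if j: "j \<in> {1..M}" for j
    proof -
      have pos: "0 < l j'" if "j' \<in> {1..M}" for j'
        using PiE_mem[of l "{1..M}" "\<lambda>_. {0<..}" j'] l that by blast
      have "real_of_int (l j) / of_int (p j) \<le> (\<Sum>j=1..M. real_of_int (l j) / of_int (p j))"
      proof (rule member_le_sum)
        fix j' assume "j' \<in> {1..M} - {j}"
        hence "j' \<in> {1..M}" by simp
        thus "0 \<le> real_of_int (l j') / of_int (p j')"
          using pos[of j'] p_ge_2[of j'] by auto
      qed (use j in auto)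
      also have "\<dots> < 1" using l by simp
      finally have "l j < p j" using p_ge_2[OF j] by (simp add: divide_less_eq)
      thus ?thesis using pos[OF j] by simp
    qed
    thus ?thesis using l unfolding ell_tuples_def by (auto simp: PiE_iff)
  qed
  have "inj_on ?class ?small"
  proof (rule inj_onI)
    fix l l' assume l: "l \<in> ?small" "l' \<in> ?small" and eq: "?class l = ?class l'"
    hence "(l, l') \<in> ell_equiv M p"
      using eq_equiv_class[OF eq equiv_ell_equiv] small_tuple by blast
    thus "l = l'" by (rule small_equiv_imp_eq) (use l in auto)
  qed
  moreover have "?class ` ?small \<subseteq> {c \<in> ell_tuples M p // ell_equiv M p. \<forall>l\<in>c. C M p l = 0}"
  proof (rule image_subsetI)
    fix l assume l: "l \<in> ?small"
    have "C M p l = 0"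
      by (rule C_eq_0_if_small[OF M small_tuple[OF l]]) (use l in simp)
    thus "?class l \<in> {c \<in> ell_tuples M p // ell_equiv M p. \<forall>l\<in>c. C M p l = 0}"
      using quotientI[OF small_tuple[OF l]] by (auto simp: C_ell_equiv)
  qed
  ultimately have "card ?small \<le> card {c \<in> ell_tuples M p // ell_equiv M p. \<forall>l\<in>c. C M p l = 0}"
    by (rule card_inj_on_le) (use finite_classes in simp)
  thus ?thesis unfolding L_def .
qed

end

theorem theorem20:
  fixes M :: nat and p :: "nat \<Rightarrow> int"
  assumes "M \<ge> 2"
    and "\<forall>j\<in>{1..M}. p j \<ge> 2"
    and "\<forall>i\<in>{1..M}. \<forall>j\<in>{1..M}. i \<noteq> j \<longrightarrow> coprime (p i) (p j)"
  shows "D M p - real (gamma M p) \<ge> real (L M p)"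
proof -
  interpret coprime_moduli M p using assms(2,3) by unfold_locales blast+
  let ?Q = "ell_tuples M p // ell_equiv M p"
  have split: "?Q = {c \<in> ?Q. \<forall>l\<in>c. C M p l = 0} \<union> {c \<in> ?Q. \<exists>l\<in>c. C M p l \<noteq> 0}" by blast
  have "card ?Q = card {c \<in> ?Q. \<forall>l\<in>c. C M p l = 0} + gamma M p"
    unfolding gamma_def
    by (subst split, rule card_Un_disjoint) (use finite_classes in auto)
  hence "real (L M p + gamma M p) \<le> real (card ?Q)"
    using L_le_card_vanishing_classes[OF assms(1)] by simp
  also have "\<dots> \<le> D M p" using card_classes_le_D assms(1) by simp
  finally show ?thesis by simp
qed

end
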